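(* Let $S\subset\mathbb{R}^2$ be a compact surface with piecewise C$^1$ boundary and let $\mathbf{F} = \begin{pmatrix} M \\ N \end{pmatrix}$ be a C$^1$ vector field on $S$. Suppose that $(R_n)$ is a sequence of solid rectangles of positive area contained in $S$, each with sides parallel to the $x$ and $y$ axes, and that as $n \to \infty$ the rectangles $R_n$ converge to a point $\mathbf{x} \in \mathbb{R}^2$. Then $$\lim_{n \to \infty} \frac{1}{\operatorname{area}(R_n)} \int_{\partial R_n} \mathbf{F} \cdot d\mathbf{s} = \operatorname{scurl} \mathbf{F}(\mathbf{x}).$$
   Context: A vector field $\mathbf{F}\colon S\to\mathbb{R}^2$ is C$^1$ if it is differentiable on $S$ with continuous derivative. The scalar curl is $\operatorname{scurl}\begin{pmatrix} M \\ N\end{pmatrix}=\frac{\partial N}{\partial x}-\frac{\partial M}{\partial y}$. For a (piecewise) C$^1$ path $\phi\colon[a,b]\to S$, $\int_\phi\mathbf{F}\cdot d\mathbf{s}=\int_a^b\mathbf{F}(\phi(t))\cdot\phi'(t)\,dt$. The boundary $\partial R_n$ is oriented counter-clockwise (so that $R_n$ is on the left). The rectangles $R_n$ converge to $\mathbf{x}$ if every neighborhood of $\mathbf{x}$ contains $R_n$ for all sufficiently large $n$. *)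

theory Defs
  imports "HOL-Analysis.Analysis"
begin

definition half_plane :: "(real^2) set" where
  "half_plane = {p. 0 \<le> p $ 2}"

definition surface_with_boundary :: "(real^2) set \<Rightarrow> bool" where
  "surface_with_boundary S \<longleftrightarrow>
     (\<forall>p\<in>S. \<exists>U V. openin (top_of_set S) U \<and> p \<in> U \<and>
                  openin (top_of_set half_plane) V \<and> U homeomorphic V)"

definition surface_boundary :: "(real^2) set \<Rightarrow> (real^2) set" where
  "surface_boundary S =
     {p \<in> S. \<exists>U V h k. openin (top_of_set S) U \<and> p \<in> U \<and>
                  openin (top_of_set half_plane) V \<and> homeomorphism U V h k \<and> h p $ 2 = 0}"

text \<open>The library's \<open>valid_path\<close> is not used here because it does not require one-sided
  derivatives at the break points. The derivative of a piece may vanish.\<close>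

definition C1_path_on :: "real set \<Rightarrow> (real \<Rightarrow> real^2) \<Rightarrow> bool" where
  "C1_path_on I g \<longleftrightarrow>
     (\<exists>g'. continuous_on I g' \<and> (\<forall>t\<in>I. (g has_vector_derivative g' t) (at t within I)))"

definition piecewise_C1_path :: "(real \<Rightarrow> real^2) \<Rightarrow> bool" where
  "piecewise_C1_path g \<longleftrightarrow>
     (\<exists>k (t :: nat \<Rightarrow> real). t 0 = 0 \<and> t k = 1 \<and>
        (\<forall>i<k. t i < t (Suc i) \<and> C1_path_on {t i..t (Suc i)} g))"

text \<open>Neither connectedness of the surface nor of its boundary is required.\<close>

definition compact_surface_piecewise_C1_boundary :: "(real^2) set \<Rightarrow> bool" where
  "compact_surface_piecewise_C1_boundary S \<longleftrightarrow>
     compact S \<and> surface_with_boundary S \<and>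
     (\<exists>G. finite G \<and>
        (\<forall>g\<in>G. simple_path g \<and> pathfinish g = pathstart g \<and> piecewise_C1_path g) \<and>
        pairwise (\<lambda>g h. disjnt (path_image g) (path_image h)) G \<and>
        surface_boundary S = (\<Union>g\<in>G. path_image g))"

text \<open>\<open>F\<close> is C1 on \<open>S\<close> with derivative \<open>F'\<close>. At boundary points the derivative is
  taken within \<open>S\<close>. At a cusp differentiability within \<open>S\<close> alone need not determine the
  derivative, so the continuous derivative is carried explicitly.\<close>

definition has_C1_derivative_on ::
  "(real^2 \<Rightarrow> real^2) \<Rightarrow> (real^2 \<Rightarrow> ((real^2) \<Rightarrow>\<^sub>L (real^2))) \<Rightarrow> (real^2) set \<Rightarrow> bool" where
  "has_C1_derivative_on F F' S \<longleftrightarrow>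
     (\<forall>p\<in>S. (F has_derivative blinfun_apply (F' p)) (at p within S)) \<and> continuous_on S F'"

text \<open>The scalar curl in terms of the Jacobian \<open>J\<close> at a point: \<open>J e\<^sub>1\<close> and
  \<open>J e\<^sub>2\<close> are the partial derivatives of the field with respect to x and y.\<close>

definition scurl :: "((real^2) \<Rightarrow>\<^sub>L (real^2)) \<Rightarrow> real" where
  "scurl J = blinfun_apply J (axis 1 1) $ 2 - blinfun_apply J (axis 2 1) $ 1"

definition line_integral :: "real \<Rightarrow> real \<Rightarrow> (real^2 \<Rightarrow> real^2) \<Rightarrow> (real \<Rightarrow> real^2) \<Rightarrow> real" where
  "line_integral a b F \<phi> =
     integral {a..b} (\<lambda>t. F (\<phi> t) \<bullet> vector_derivative \<phi> (at t within {a..b}))"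

text \<open>The counter-clockwise boundary path of \<open>cbox a b\<close>, parametrised on [0,1] and
  starting at the lower left corner \<open>a\<close>; the analogue of \<open>rectpath\<close> in the complex plane.\<close>

definition rect_boundary :: "real^2 \<Rightarrow> real^2 \<Rightarrow> real \<Rightarrow> real^2" where
  "rect_boundary a b =
     linepath a (vector [b $ 1, a $ 2]) +++ linepath (vector [b $ 1, a $ 2]) b +++
     linepath b (vector [a $ 1, b $ 2]) +++ linepath (vector [a $ 1, b $ 2]) a"

definition sets_converge_to :: "(nat \<Rightarrow> (real^2) set) \<Rightarrow> real^2 \<Rightarrow> bool" where
  "sets_converge_to R x \<longleftrightarrow>
     (\<forall>U. open U \<longrightarrow> x \<in> U \<longrightarrow> (\<forall>\<^sub>F n in sequentially. R n \<subseteq> U))"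

end

theory Submission
  imports Defs
begin

text \<open>
  The circulation around a rectangle pairs each side with the opposite one. With sides
  \<open>u\<close> and \<open>v\<close> at the corner \<open>p\<close>, the bottom and top sides together contribute
  \<open>\<integral> (F (p + s u) - F (p + s u + v)) \<bullet> u ds\<close>, and the other two sides contribute
  \<open>\<integral> (F (p + u + s v) - F (p + s v)) \<bullet> v ds\<close>. If the derivative of \<open>F\<close> stays
  within \<open>\<epsilon>\<close> of the fixed linear map \<open>A\<close> on the rectangle, the mean value inequality replaces
  the differences by \<open>- A v\<close> and \<open>A u\<close> with errors at most \<open>\<epsilon> |v|\<close> and \<open>\<epsilon> |u|\<close>
  (\<open>opposite_segments_work\<close>). The circulation is thus \<open>A u \<bullet> v - A v \<bullet> u\<close> up to
  \<open>2 \<epsilon> |u| |v|\<close> (\<open>circulation_parallelogram_estimate\<close>). For sides along the axes the main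
  term is the area times the scalar curl of \<open>A\<close>, and the error is at most \<open>2 \<epsilon>\<close> times
  the area, however thin the rectangle is.

  Since \<open>S\<close> is closed, the limit point lies in \<open>S\<close>, even though it need not lie in any of the
  rectangles. Continuity of the derivative there makes
  \<open>\<epsilon>\<close> arbitrarily small once the rectangles are close enough to the point, with
  \<open>A\<close> the derivative at that point.
\<close>

definition segment_work ::
  "('a::euclidean_space \<Rightarrow> 'a) \<Rightarrow> 'a \<Rightarrow> 'a \<Rightarrow> real" where
  "segment_work F p q = integral {0..1} (\<lambda>s. F (linepath p q s) \<bullet> (q - p))"

lemma continuous_on_segment_integrand:
  fixes F :: "'a::euclidean_space \<Rightarrow> 'a"
  assumes "continuous_on (closed_segment p q) F"
  shows "continuous_on {0..1} (\<lambda>s. F (linepath p q s) \<bullet> w)"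
proof -
  have "continuous_on {0..1} (\<lambda>s. F (linepath p q s))"
    by (rule continuous_on_compose2[OF assms continuous_on_linepath]) (simp add: linepath_image_01)
  then show ?thesis
    by (intro continuous_intros)
qed

lemma has_integral_segment_work:
  fixes F :: "'a::euclidean_space \<Rightarrow> 'a"
  assumes "continuous_on (closed_segment p q) F"
  shows "((\<lambda>s. F (linepath p q s) \<bullet> (q - p)) has_integral segment_work F p q) {0..1}"
  unfolding segment_work_def
  by (intro integrable_integral integrable_continuous_real continuous_on_segment_integrand assms)

lemma segment_work_reverse:
  fixes F :: "'a::euclidean_space \<Rightarrow> 'a"
  assumes "continuous_on (closed_segment p q) F"
  shows "segment_work F q p = - segment_work F p q"
proof -
  have "((\<lambda>s. F (linepath p q (1 - s)) \<bullet> (q - p)) has_integral segment_work F p q) {0..1}"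
    using has_integral_affinity01[OF has_integral_segment_work[OF assms], of "-1" 1] by simp
  then have "((\<lambda>s. - (F (linepath p q (1 - s)) \<bullet> (q - p))) has_integral - segment_work F p q) {0..1}"
    by (rule has_integral_neg)
  moreover have "- (F (linepath p q (1 - s)) \<bullet> (q - p)) = F (linepath q p s) \<bullet> (p - q)" for s
    by (simp add: linepath_def algebra_simps)
  ultimately show ?thesis
    unfolding segment_work_def[of F q p] by (simp add: integral_unique)
qed

text \<open>At the ends of the interval the path may turn a corner, and there the derivative in the
  integrand is an arbitrary value; two points do not affect the integral. For the same reason it is
  enough to know the path strictly inside the interval.\<close>

lemma has_integral_along_segment:
  fixes F :: "'a::euclidean_space \<Rightarrow> 'a"
  assumes F: "continuous_on (closed_segment p q) F"
    and uv: "0 \<le> u" "u < v" "v \<le> 1"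
    and g: "\<And>t. u < t \<Longrightarrow> t < v \<Longrightarrow> g t = linepath p q ((t - u) / (v - u))"
  shows "((\<lambda>t. F (g t) \<bullet> vector_derivative g (at t within {0..1}))
            has_integral segment_work F p q) {u..v}"
proof -
  let ?k = "1 / (v - u)"
  let ?h = "\<lambda>t. F (linepath p q ((t - u) / (v - u))) \<bullet> (?k *\<^sub>R (q - p))"
  have k: "?k > 0" "(0 - - u * ?k) /\<^sub>R ?k = u" "(1 - - u * ?k) /\<^sub>R ?k = v"
    "?k *\<^sub>R t + - u * ?k = (t - u) / (v - u)" for t
    using uv by (simp_all add: diff_divide_distrib) (simp add: field_simps)
  have "((\<lambda>s. F (linepath p q s) \<bullet> (q - p)) has_integral segment_work F p q) (cbox 0 1)"
    using has_integral_segment_work[OF F] by simp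
  from has_integral_affinity'[OF this k(1), of "- u * ?k", unfolded k]
  have "((\<lambda>t. F (linepath p q ((t - u) / (v - u))) \<bullet> (q - p)) has_integral
          (v - u) * segment_work F p q) {u..v}"
    by simp
  then have "((\<lambda>t. ?k * (F (linepath p q ((t - u) / (v - u))) \<bullet> (q - p))) has_integral
          ?k * ((v - u) * segment_work F p q)) {u..v}"
    by (rule has_integral_mult_right)
  then have h: "(?h has_integral segment_work F p q) {u..v}"
    using uv by simp
  have "F (g t) \<bullet> vector_derivative g (at t within {0..1}) = ?h t" if t: "t \<in> {u..v} - {u, v}" for t
  proof -
    have "((\<lambda>t. linepath p q ((t - u) / (v - u))) has_vector_derivative ?k *\<^sub>R (q - p)) (at t)"
      unfolding has_vector_derivative_def linepath_def
      using uv by (auto intro!: derivative_eq_intros simp: fun_eq_iff scaleR_right_diff_distrib)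
    then have "(g has_vector_derivative ?k *\<^sub>R (q - p)) (at t)"
      by (rule has_vector_derivative_transform_within_open[where S = "{u<..<v}"])
        (use t g in auto)
    then have "vector_derivative g (at t within {0..1}) = ?k *\<^sub>R (q - p)"
      by (rule vector_derivative_at_within_ivl) (use t uv in auto)
    then show ?thesis
      using g[of t] t by simp
  qed
  then show ?thesis
    by (intro has_integral_spike_finite[of "{u, v}", OF _ _ h]) auto
qed

text \<open>Iterated \<open>+++\<close> associates to the right and halves the remaining parameter interval each
  time, so the four sides are traversed on \<open>[0, 1/2]\<close>, \<open>[1/2, 3/4]\<close>, \<open>[3/4, 7/8]\<close> and
  \<open>[7/8, 1]\<close>.\<close>

lemma line_integral_quadrilateral:
  assumes F: "continuous_on (closed_segment p q) F" "continuous_on (closed_segment q r) F"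
      "continuous_on (closed_segment r s) F" "continuous_on (closed_segment s p) F"
  shows "line_integral 0 1 F (linepath p q +++ linepath q r +++ linepath r s +++ linepath s p) =
    segment_work F p q + segment_work F q r + segment_work F r s + segment_work F s p"
proof -
  let ?g = "linepath p q +++ linepath q r +++ linepath r s +++ linepath s p"
  let ?f = "\<lambda>t. F (?g t) \<bullet> vector_derivative ?g (at t within {0..1})"
  have 1: "(?f has_integral segment_work F p q) {0..1/2}"
    by (rule has_integral_along_segment[OF F(1)]) (auto simp: joinpaths_def mult.commute)
  have 2: "(?f has_integral segment_work F q r) {1/2..3/4}"
    by (rule has_integral_along_segment[OF F(2)]) (auto simp: joinpaths_def algebra_simps)
  have 3: "(?f has_integral segment_work F r s) {3/4..7/8}"
    by (rule has_integral_along_segment[OF F(3)]) (auto simp: joinpaths_def algebra_simps)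
  have 4: "(?f has_integral segment_work F s p) {7/8..1}"
    by (rule has_integral_along_segment[OF F(4)]) (auto simp: joinpaths_def algebra_simps)
  have "(?f has_integral
      segment_work F p q + segment_work F q r + segment_work F r s + segment_work F s p) {0..1}"
    using has_integral_combine[OF _ _ has_integral_combine[OF _ _ has_integral_combine[OF _ _ 1 2] 3] 4]
    by simp
  then show ?thesis
    unfolding line_integral_def by (rule integral_unique)
qed

lemma increment_near_linear:
  fixes F :: "'a::real_normed_vector \<Rightarrow> 'b::real_normed_vector"
    and A :: "'a \<Rightarrow>\<^sub>L 'b"
  assumes T: "convex T"
    and F: "\<And>z. z \<in> T \<Longrightarrow> (F has_derivative blinfun_apply (F' z)) (at z within T)"
    and near: "\<And>z. z \<in> T \<Longrightarrow> norm (F' z - A) \<le> e"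
    and z: "z \<in> T" "z + w \<in> T"
  shows "norm (F (z + w) - F z - A w) \<le> e * norm w"
proof -
  have "norm ((F (z + w) - A (z + w)) - (F z - A z)) \<le> e * norm ((z + w) - z)"
  proof (rule differentiable_bound[OF T _ _ z(2,1)])
    show "((\<lambda>y. F y - A y) has_derivative blinfun_apply (F' y - A)) (at y within T)" if "y \<in> T" for y
      using F[OF that] by (auto intro!: derivative_eq_intros simp: blinfun.diff_left)
    show "onorm (blinfun_apply (F' y - A)) \<le> e" if "y \<in> T" for y
      using near[OF that] by (simp add: norm_blinfun.rep_eq)
  qed
  then show ?thesis
    by (simp add: blinfun.add_right algebra_simps)
qed

text \<open>The factor \<open>|w|\<close> in the error comes from the mean value inequality across the strip, not
  from the size of \<open>F\<close> along it; this is what keeps the bound proportional to the area of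
  a long thin rectangle.\<close>

lemma opposite_segments_work:
  fixes F :: "'a::euclidean_space \<Rightarrow> 'a" and A :: "'a \<Rightarrow>\<^sub>L 'a"
  assumes T: "convex T"
    and F: "\<And>z. z \<in> T \<Longrightarrow> (F has_derivative blinfun_apply (F' z)) (at z within T)"
    and near: "\<And>z. z \<in> T \<Longrightarrow> norm (F' z - A) \<le> e"
    and corners: "p \<in> T" "p + d \<in> T" "p + w \<in> T" "p + w + d \<in> T"
  shows "\<bar>segment_work F (p + w) (p + w + d) - segment_work F p (p + d) - A w \<bullet> d\<bar>
    \<le> e * norm w * norm d"
proof -
  have contF: "continuous_on T F"
    using F by (rule has_derivative_continuous_on)
  have seg: "closed_segment p (p + d) \<subseteq> T" "closed_segment (p + w) (p + w + d) \<subseteq> T"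
    using T corners by (simp_all add: closed_segment_subset)
  note cont = continuous_on_subset[OF contF seg(1)] continuous_on_subset[OF contF seg(2)]
  let ?f = "\<lambda>s. F (linepath (p + w) (p + w + d) s) \<bullet> d - F (linepath p (p + d) s) \<bullet> d - A w \<bullet> d"
  have "(?f has_integral
      segment_work F (p + w) (p + w + d) - segment_work F p (p + d) - A w \<bullet> d) {0..1}"
    using has_integral_segment_work[OF cont(1)] has_integral_segment_work[OF cont(2)]
      has_integral_const_real[of "A w \<bullet> d" 0 1]
    by (intro has_integral_diff) simp_all
  then have "segment_work F (p + w) (p + w + d) - segment_work F p (p + d) - A w \<bullet> d =
      integral {0..1} ?f"
    by (rule integral_unique[symmetric])
  moreover have "norm (integral {0..1} ?f) \<le> e * norm w * norm d * (1 - 0)"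
  proof (rule integral_bound)
    show "continuous_on {0..1} ?f"
      by (intro continuous_on_diff continuous_on_const continuous_on_segment_integrand cont)
    fix s :: real assume s: "s \<in> {0..1}"
    let ?z = "linepath p (p + d) s"
    have shift: "linepath (p + w) (p + w + d) s = ?z + w"
      by (simp add: linepath_def algebra_simps)
    have "?z \<in> T" "?z + w \<in> T"
      using seg linepath_in_path[OF s, of p "p + d"] linepath_in_path[OF s, of "p + w" "p + w + d"]
      by (auto simp: shift)
    then have "norm (F (?z + w) - F ?z - A w) \<le> e * norm w"
      using increment_near_linear[OF T F near] by blast
    then have "norm (F (?z + w) - F ?z - A w) * norm d \<le> e * norm w * norm d"
      by (simp add: mult_right_mono)
    then have "\<bar>(F (?z + w) - F ?z - A w) \<bullet> d\<bar> \<le> e * norm w * norm d"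
      using Cauchy_Schwarz_ineq2 order_trans by blast
    then show "norm (?f s) \<le> e * norm w * norm d"
      by (simp add: shift inner_diff_left)
  qed simp
  ultimately show ?thesis
    by simp
qed

lemma circulation_parallelogram_estimate:
  fixes A :: "(real^2) \<Rightarrow>\<^sub>L (real^2)"
  assumes T: "convex T"
    and F: "\<And>z. z \<in> T \<Longrightarrow> (F has_derivative blinfun_apply (F' z)) (at z within T)"
    and near: "\<And>z. z \<in> T \<Longrightarrow> norm (F' z - A) \<le> e"
    and corners: "p \<in> T" "p + u \<in> T" "p + v \<in> T" "p + u + v \<in> T"
  shows "\<bar>line_integral 0 1 F (linepath p (p + u) +++ linepath (p + u) (p + u + v) +++
      linepath (p + u + v) (p + v) +++ linepath (p + v) p) - (A u \<bullet> v - A v \<bullet> u)\<bar>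
    \<le> 2 * e * norm u * norm v"
proof -
  have contF: "continuous_on T F"
    using F by (rule has_derivative_continuous_on)
  have cont: "continuous_on (closed_segment y z) F" if "y \<in> T" "z \<in> T" for y z
    using that T contF by (meson closed_segment_subset continuous_on_subset)
  have swap: "p + v + u = p + u + v"
    by (simp add: algebra_simps)
  have "segment_work F (p + u + v) (p + v) = - segment_work F (p + v) (p + u + v)"
    "segment_work F (p + v) p = - segment_work F p (p + v)"
    using corners by (auto intro!: segment_work_reverse cont)
  then have "line_integral 0 1 F (linepath p (p + u) +++ linepath (p + u) (p + u + v) +++
        linepath (p + u + v) (p + v) +++ linepath (p + v) p) - (A u \<bullet> v - A v \<bullet> u) =
      (segment_work F (p + u) (p + u + v) - segment_work F p (p + v) - A u \<bullet> v)
      - (segment_work F (p + v) (p + u + v) - segment_work F p (p + u) - A v \<bullet> u)"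
    using corners by (subst line_integral_quadrilateral) (auto intro!: cont)
  moreover have "\<bar>segment_work F (p + u) (p + u + v) - segment_work F p (p + v) - A u \<bullet> v\<bar>
      \<le> e * norm u * norm v"
    using opposite_segments_work[OF T F near, of p v u] corners by simp
  moreover have "\<bar>segment_work F (p + v) (p + u + v) - segment_work F p (p + u) - A v \<bullet> u\<bar>
      \<le> e * norm v * norm u"
    using opposite_segments_work[OF T F near, of p u v] corners by (simp add: swap)
  ultimately show ?thesis
    by (simp add: algebra_simps)
qed

lemma positive_area_rectangle:
  fixes a b :: "real^2"
  assumes "measure lborel (cbox a b) > 0"
  shows "a $ 1 < b $ 1" "a $ 2 < b $ 2"
    and "measure lborel (cbox a b) = (b $ 1 - a $ 1) * (b $ 2 - a $ 2)"
proof -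
  have ne: "cbox a b \<noteq> {}"
    using assms by auto
  then show area: "measure lborel (cbox a b) = (b $ 1 - a $ 1) * (b $ 2 - a $ 2)"
    by (simp add: content_cbox_cart UNIV_2)
  have "a $ 1 \<le> b $ 1" "a $ 2 \<le> b $ 2"
    using ne by (simp_all add: interval_ne_empty_cart)
  moreover have "a $ 1 \<noteq> b $ 1" "a $ 2 \<noteq> b $ 2"
    using assms area by auto
  ultimately show "a $ 1 < b $ 1" "a $ 2 < b $ 2"
    by simp_all
qed

lemma mean_circulation_rectangle_estimate:
  fixes a b :: "real^2" and A :: "(real^2) \<Rightarrow>\<^sub>L (real^2)"
  assumes area: "measure lborel (cbox a b) > 0"
    and F: "\<And>z. z \<in> cbox a b \<Longrightarrow> (F has_derivative blinfun_apply (F' z)) (at z within cbox a b)"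
    and near: "\<And>z. z \<in> cbox a b \<Longrightarrow> norm (F' z - A) \<le> e"
  shows "\<bar>1 / measure lborel (cbox a b) * line_integral 0 1 F (rect_boundary a b) - scurl A\<bar> \<le> 2 * e"
proof -
  let ?m = "measure lborel (cbox a b)"
  let ?l = "line_integral 0 1 F (rect_boundary a b)"
  note ab = positive_area_rectangle[OF area]
  define u v :: "real^2"
    where "u = (b $ 1 - a $ 1) *\<^sub>R axis 1 1" and "v = (b $ 2 - a $ 2) *\<^sub>R axis 2 1"
  have corners: "vector [b $ 1, a $ 2] = a + u" "vector [a $ 1, b $ 2] = a + v" "b = a + u + v"
    by (simp_all add: vec_eq_iff forall_2 u_def v_def axis_def)
  have inside: "a \<in> cbox a b" "a + u \<in> cbox a b" "a + v \<in> cbox a b" "a + u + v \<in> cbox a b"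
    using ab by (auto simp: mem_box_cart forall_2 u_def v_def axis_def)
  have "rect_boundary a b = linepath a (a + u) +++ linepath (a + u) (a + u + v) +++
      linepath (a + u + v) (a + v) +++ linepath (a + v) a"
    unfolding rect_boundary_def corners(1,2) corners(3)[symmetric] ..
  then have "\<bar>?l - (A u \<bullet> v - A v \<bullet> u)\<bar> \<le> 2 * e * norm u * norm v"
    using circulation_parallelogram_estimate[OF convex_box(1) F near inside] by simp
  moreover have "A u \<bullet> v - A v \<bullet> u = ?m * scurl A"
    unfolding u_def v_def ab(3) scurl_def blinfun.scaleR_right
    by (simp add: inner_axis algebra_simps)
  moreover have "norm u * norm v = ?m"
    using ab by (simp add: u_def v_def norm_axis_1)
  ultimately have "\<bar>?l - ?m * scurl A\<bar> \<le> 2 * e * ?m"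
    by (simp add: mult.assoc)
  moreover have "1 / ?m * ?l - scurl A = (?l - ?m * scurl A) / ?m"
    using area by (simp add: field_simps)
  ultimately show ?thesis
    using area by (simp add: abs_divide pos_divide_le_eq)
qed

lemma sets_converge_to_limit_in_closed:
  assumes "closed S" and "\<And>n. R n \<subseteq> S" and "\<And>n. R n \<noteq> {}" and "sets_converge_to R x"
  shows "x \<in> S"
proof (rule ccontr)
  assume "x \<notin> S"
  with assms(1,4) have "\<forall>\<^sub>F n in sequentially. R n \<subseteq> - S"
    by (auto simp: sets_converge_to_def)
  then obtain n where "R n \<subseteq> - S"
    using eventually_happens by fastforce
  with assms(2,3)[of n] show False
    by blast
qed

theorem corollary2p5:
  fixes S :: "(real^2) set"
    and F :: "real^2 \<Rightarrow> real^2"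
    and F' :: "real^2 \<Rightarrow> ((real^2) \<Rightarrow>\<^sub>L (real^2))"
    and a b :: "nat \<Rightarrow> real^2"
    and x :: "real^2"
  assumes "compact_surface_piecewise_C1_boundary S"
    and "has_C1_derivative_on F F' S"
    and "\<And>n. measure lborel (cbox (a n) (b n)) > 0"
    and "\<And>n. cbox (a n) (b n) \<subseteq> S"
    and "sets_converge_to (\<lambda>n. cbox (a n) (b n)) x"
  shows "(\<lambda>n. 1 / measure lborel (cbox (a n) (b n)) *
               line_integral 0 1 F (rect_boundary (a n) (b n)))
         \<longlonglongrightarrow> scurl (F' x)"
proof -
  have der: "(F has_derivative blinfun_apply (F' p)) (at p within S)" if "p \<in> S" for p
    using assms(2) that by (simp add: has_C1_derivative_on_def)
  have cont: "continuous_on S F'"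
    using assms(2) by (simp add: has_C1_derivative_on_def)
  have "closed S"
    using assms(1) by (simp add: compact_surface_piecewise_C1_boundary_def compact_imp_closed)
  moreover have "cbox (a n) (b n) \<noteq> {}" for n
    using assms(3)[of n] by auto
  ultimately have xS: "x \<in> S"
    by (rule sets_converge_to_limit_in_closed[OF _ assms(4) _ assms(5)])
  show ?thesis
  proof (rule LIMSEQ_I)
    fix r :: real assume "r > 0"
    \<comment> \<open>A derivative error of \<open>r / 3\<close> costs \<open>2 r / 3 < r\<close> in the mean circulation.\<close>
    then obtain d where d: "d > 0" "\<And>y. y \<in> S \<Longrightarrow> dist y x < d \<Longrightarrow> dist (F' y) (F' x) < r / 3"
      using cont[unfolded continuous_on_iff, rule_format, OF xS, of "r / 3"] by auto
    from assms(5) d(1) have "\<forall>\<^sub>F n in sequentially. cbox (a n) (b n) \<subseteq> ball x d"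
      by (simp add: sets_converge_to_def)
    then obtain N where N: "\<And>n. n \<ge> N \<Longrightarrow> cbox (a n) (b n) \<subseteq> ball x d"
      by (auto simp: eventually_sequentially)
    have "norm (1 / measure lborel (cbox (a n) (b n)) *
        line_integral 0 1 F (rect_boundary (a n) (b n)) - scurl (F' x)) < r" if "n \<ge> N" for n
    proof -
      have "\<bar>1 / measure lborel (cbox (a n) (b n)) *
          line_integral 0 1 F (rect_boundary (a n) (b n)) - scurl (F' x)\<bar> \<le> 2 * (r / 3)"
      proof (rule mean_circulation_rectangle_estimate[OF assms(3)])
        fix z assume z: "z \<in> cbox (a n) (b n)"
        with assms(4) have zS: "z \<in> S" by blast
        show "(F has_derivative blinfun_apply (F' z)) (at z within cbox (a n) (b n))"
          using der[OF zS] assms(4) by (rule has_derivative_subset)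
        have "dist z x < d"
          using N[OF that] z by (auto simp: dist_commute)
        with d(2)[OF zS] show "norm (F' z - F' x) \<le> r / 3"
          by (simp add: dist_norm less_imp_le)
      qed
      with \<open>r > 0\<close> show ?thesis
        by simp
    qed
    then show "\<exists>N. \<forall>n\<ge>N. norm (1 / measure lborel (cbox (a n) (b n)) *
        line_integral 0 1 F (rect_boundary (a n) (b n)) - scurl (F' x)) < r"
      by blast
  qed
qed

end
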